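(* For every integer $d\geq1$ and every $\alpha\in(0,1/2)$, there exists a constant $C>0$ such that the following holds for any function $r=r(n)$ with $r\geq(C/n)^{1/d}$. For each $n$, let $H=H_n$ be any graph on vertex set $[n]=\{1,\dots,n\}$ with minimum degree at least $\alpha n$. Then asymptotically almost surely (as $n\to\infty$) the graph $H\cup G^d(n,r)$ on vertex set $[n]$, where $G^d(n,r)$ is the random geometric graph on $[n]$ and the edge set of the union is the union of the two edge sets, contains a Hamilton cycle (a cycle passing through every vertex exactly once).
   Context: The $d$-dimensional random geometric graph $G^d(n,r)$ is defined as follows: let $X_1,\dots,X_n$ be independent random points, each uniformly distributed on $[0,1]^d$, and let $r>0$; the graph has vertex set $[n]$ and edge set $\{\{i,j\}: i\neq j,\ \lVert X_i-X_j\rVert\leq r\}$, where $\lVert\cdot\rVert$ is the Euclidean norm. A sequence of events $\mathcal{E}_n$ holds asymptotically almost surely (a.a.s.) if $\mathbb{P}[\mathcal{E}_n]\to1$ as $n\to\infty$. *)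

theory Defs
  imports "HOL-Probability.Probability"
begin

(* Edges of a simple graph are two-element sets of vertices. *)
definition simple_graph :: "'a set \<Rightarrow> 'a set set \<Rightarrow> bool" where
  "simple_graph V E \<longleftrightarrow> finite V \<and> (\<forall>e\<in>E. e \<subseteq> V \<and> card e = 2)"

definition vertex_degree :: "'a set set \<Rightarrow> 'a \<Rightarrow> nat" where
  "vertex_degree E v = card {e \<in> E. v \<in> e}"

(* Only meaningful for a finite nonempty vertex set. *)
definition min_degree :: "'a set \<Rightarrow> 'a set set \<Rightarrow> nat" where
  "min_degree V E = Min (vertex_degree E ` V)"

(* The list enumerates the vertices in cyclic order. A cycle has at least three vertices. *)
definition hamilton_cycle :: "'a set \<Rightarrow> 'a set set \<Rightarrow> 'a list \<Rightarrow> bool" where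
  "hamilton_cycle V E vs \<longleftrightarrow>
     distinct vs \<and> set vs = V \<and> length vs \<ge> 3 \<and>
     (\<forall>i<length vs. {vs ! i, vs ! (Suc i mod length vs)} \<in> E)"

definition has_hamilton_cycle :: "'a set \<Rightarrow> 'a set set \<Rightarrow> bool" where
  "has_hamilton_cycle V E \<longleftrightarrow> (\<exists>vs. hamilton_cycle V E vs)"

(* The joint law of n independent points, each uniform on the unit cube. *)
definition uniform_points :: "nat \<Rightarrow> (nat \<Rightarrow> real ^ 'd) measure" where
  "uniform_points n = (\<Pi>\<^sub>M i\<in>{1..n}. uniform_measure lborel {p. \<forall>k. 0 \<le> p $ k \<and> p $ k \<le> 1})"

(* The norm on real ^ 'd is the Euclidean one. *)
definition geometric_graph :: "nat \<Rightarrow> real \<Rightarrow> (nat \<Rightarrow> real ^ 'd) \<Rightarrow> nat set set" where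
  "geometric_graph n r X =
     {{i, j} |i j. i \<in> {1..n} \<and> j \<in> {1..n} \<and> i \<noteq> j \<and> norm (X i - X j) \<le> r}"

definition asymptotically_almost_surely ::
    "(nat \<Rightarrow> 'w measure) \<Rightarrow> (nat \<Rightarrow> 'w \<Rightarrow> bool) \<Rightarrow> bool" where
  "asymptotically_almost_surely M P \<longleftrightarrow>
     (\<lambda>n. measure (M n) {\<omega> \<in> space (M n). P n \<omega>}) \<longlonglongrightarrow> 1"

lemma unit_cube_eq_cbox: "{p :: real ^ 'd. \<forall>k. 0 \<le> p $ k \<and> p $ k \<le> 1} = cbox 0 1"
  by (auto simp: mem_box_cart)

lemma prob_space_uniform_points: "prob_space (uniform_points n :: (nat \<Rightarrow> real ^ 'd) measure)"
proof -
  have "emeasure lborel (cbox 0 1 :: (real ^ 'd) set) = 1"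
    by (subst emeasure_lborel_cbox) (auto simp: Basis_vec_def inner_axis intro!: prod.neutral)
  then have "prob_space (uniform_measure lborel (cbox 0 1 :: (real ^ 'd) set))"
    by (intro prob_space_uniform_measure) auto
  then show ?thesis
    unfolding uniform_points_def unit_cube_eq_cbox by (intro prob_space_PiM) auto
qed

lemma doubleton_in_geometric_graph:
  "{i, j} \<in> geometric_graph n r X \<longleftrightarrow>
     i \<in> {1..n} \<and> j \<in> {1..n} \<and> i \<noteq> j \<and> norm (X i - X j) \<le> r"
  unfolding geometric_graph_def by (auto simp: doubleton_eq_iff norm_minus_commute)

(* The event in question is measurable, so its measure really is a probability. *)
lemma sets_has_hamilton_cycle:
  "{X \<in> space (uniform_points n). has_hamilton_cycle {1..n} (E \<union> geometric_graph n r X)}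
     \<in> sets (uniform_points n :: (nat \<Rightarrow> real ^ 'd) measure)"
proof -
  let ?M = "uniform_points n :: (nat \<Rightarrow> real ^ 'd) measure"
  define L where "L = {vs. distinct vs \<and> set vs = {1..n} \<and> length vs \<ge> 3}"
  have "finite L"
    by (rule finite_subset[OF _ finite_subset_distinct[of "{1..n}"]]) (auto simp: L_def)
  have pt: "(\<lambda>X. X i) \<in> borel_measurable ?M" if "i \<in> {1..n}" for i
  proof -
    have "(\<lambda>X. X i) \<in> measurable ?M (uniform_measure lborel {p. \<forall>k. 0 \<le> p $ k \<and> p $ k \<le> 1})"
      unfolding uniform_points_def using that by (rule measurable_component_singleton)
    then show ?thesis
      by (simp cong: measurable_cong_sets)
  qed
  have edge: "{X \<in> space ?M. {i, j} \<in> E \<union> geometric_graph n r X} \<in> sets ?M" for i j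
  proof (cases "{i, j} \<notin> E \<and> i \<in> {1..n} \<and> j \<in> {1..n} \<and> i \<noteq> j")
    case True
    then have [measurable]: "(\<lambda>X. X i) \<in> borel_measurable ?M" "(\<lambda>X. X j) \<in> borel_measurable ?M"
      using pt by blast+
    have "{X \<in> space ?M. norm (X i - X j) \<le> r} \<in> sets ?M"
      by measurable
    with True show ?thesis
      by (simp add: doubleton_in_geometric_graph)
  next
    case False
    then consider "{i, j} \<in> E" | "\<And>X :: nat \<Rightarrow> real ^ 'd. {i, j} \<notin> geometric_graph n r X" "{i, j} \<notin> E"
      by (auto simp: doubleton_in_geometric_graph)
    then show ?thesis
      by cases simp_all
  qed
  have "{X \<in> space ?M. \<exists>vs\<in>L. \<forall>i\<in>{..<length vs}.
      {vs ! i, vs ! (Suc i mod length vs)} \<in> E \<union> geometric_graph n r X} \<in> sets ?M"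
    using \<open>finite L\<close> edge by (intro sets.sets_Collect_finite_Ex sets.sets_Collect_finite_All) auto
  also have "{X \<in> space ?M. \<exists>vs\<in>L. \<forall>i\<in>{..<length vs}.
      {vs ! i, vs ! (Suc i mod length vs)} \<in> E \<union> geometric_graph n r X} =
    {X \<in> space ?M. has_hamilton_cycle {1..n} (E \<union> geometric_graph n r X)}"
    by (auto simp: has_hamilton_cycle_def hamilton_cycle_def L_def)
  finally show ?thesis .
qed

end

theory Submission
  imports Defs
begin

text \<open>Cut the cube into \<open>N = m\<^sup>d \<le> n / K\<close> cells of diameter at most \<open>r\<close>, so that the points of a cell form
  a clique. By a Chernoff bound and a union bound over sets of cells, a.a.s. every vertex has at least
  two \<open>H\<close>-neighbours in all but \<open>N / 8\<close> cells. Call two nonempty cells linked if they are joined by an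
  edge of \<open>H\<close> even after forbidding one vertex in each of them (unless it is the only one). Every
  nonempty cell is then linked to at least half of the cells, so Dirac's theorem arranges the cells in
  a cycle, and this cycle is threaded through the cliques. The adjacency of different cells in the
  geometric graph is never needed.\<close>

section \<open>Dirac's theorem, by removing gaps from a cyclic ordering\<close>

fun gaps :: "('a \<Rightarrow> 'a \<Rightarrow> bool) \<Rightarrow> 'a list \<Rightarrow> nat" where
  "gaps R (x # y # xs) = of_bool (\<not> R x y) + gaps R (y # xs)"
| "gaps R _ = 0"

lemma gaps_append:
  "xs \<noteq> [] \<Longrightarrow> ys \<noteq> [] \<Longrightarrow>
    gaps R (xs @ ys) = gaps R xs + gaps R ys + of_bool (\<not> R (last xs) (hd ys))"
  by (induction R xs rule: gaps.induct) (auto simp: neq_Nil_conv)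

lemma gaps_rev: "symp R \<Longrightarrow> gaps R (rev xs) = gaps R xs"
proof (induction R xs rule: gaps.induct)
  case (1 R x y xs)
  then have "R y x \<longleftrightarrow> R x y"
    by (auto dest: sympD)
  with 1 show ?case
    using gaps_append[of "rev xs @ [y]" "[x]" R] by simp
qed auto

lemma gaps_eq_0_iff: "gaps R xs = 0 \<longleftrightarrow> successively R xs"
  by (induction R xs rule: gaps.induct) auto

lemma gaps_pos_split:
  assumes "gaps R xs > 0"
  obtains ys zs where "xs = ys @ zs" "ys \<noteq> []" "zs \<noteq> []" "\<not> R (last ys) (hd zs)"
proof -
  have "\<exists>ys zs. xs = ys @ zs \<and> ys \<noteq> [] \<and> zs \<noteq> [] \<and> \<not> R (last ys) (hd zs)"
    using assms
  proof (induction R xs rule: gaps.induct)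
    case (1 R x y xs)
    show ?case
    proof (cases "R x y")
      case True
      with 1 obtain ys zs where "y # xs = ys @ zs" "ys \<noteq> []" "zs \<noteq> []" "\<not> R (last ys) (hd zs)"
        by auto
      then show ?thesis
        by (intro exI[of _ "x # ys"] exI[of _ zs]) auto
    next
      case False
      then show ?thesis
        by (intro exI[of _ "[x]"] exI[of _ "y # xs"]) auto
    qed
  qed auto
  then show thesis using that by blast
qed

text \<open>The quantity minimised in the proof of Dirac's theorem. It is invariant under rotation
  of the list, so any gap can be moved to the closing pair.\<close>

definition cyclic_gaps :: "('a \<Rightarrow> 'a \<Rightarrow> bool) \<Rightarrow> 'a list \<Rightarrow> nat" where
  "cyclic_gaps R xs = gaps R xs + of_bool (\<not> R (last xs) (hd xs))"

lemma cyclic_gaps_append: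
  "xs \<noteq> [] \<Longrightarrow> ys \<noteq> [] \<Longrightarrow> cyclic_gaps R (xs @ ys) =
    gaps R xs + gaps R ys + of_bool (\<not> R (last xs) (hd ys)) + of_bool (\<not> R (last ys) (hd xs))"
  by (simp add: cyclic_gaps_def gaps_append)

text \<open>If \<open>R z x\<^sub>j\<close> and \<open>R a x\<^sub>j\<^sub>+\<^sub>1\<close> for \<open>a\<close>, \<open>z\<close> the first and last element, then reversing the
  initial segment up to \<open>x\<^sub>j\<close> removes the gap between \<open>z\<close> and \<open>a\<close>; the degrees force such a \<open>j\<close>.\<close>

lemma two_opt:
  assumes "symp R" "distinct xs" "xs \<noteq> []" "\<not> R (last xs) (hd xs)"
    and irr: "\<And>x. \<not> R x x"
    and deg: "\<And>x. x \<in> set xs \<Longrightarrow> length xs \<le> 2 * card {y \<in> set xs. R x y}"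
  obtains ys where "set ys = set xs" "distinct ys" "cyclic_gaps R ys < cyclic_gaps R xs"
proof -
  define l where "l = length xs"
  define P where "P = {j. j < l - 1 \<and> R (last xs) (xs ! j)}"
  define Q where "Q = {j. j < l - 1 \<and> R (hd xs) (xs ! Suc j)}"
  have l: "l > 0" "last xs = xs ! (l - 1)" "hd xs = xs ! 0"
    using assms(3) by (auto simp: l_def last_conv_nth hd_conv_nth)
  have "{y \<in> set xs. R (last xs) y} \<subseteq> (\<lambda>j. xs ! j) ` P"
  proof
    fix y assume y: "y \<in> {y \<in> set xs. R (last xs) y}"
    then obtain j where j: "j < l" "y = xs ! j"
      by (auto simp: in_set_conv_nth l_def)
    with y irr l have "j \<noteq> l - 1" by auto
    with j y show "y \<in> (\<lambda>j. xs ! j) ` P" by (auto simp: P_def)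
  qed
  moreover have "finite P" "finite Q" by (auto simp: P_def Q_def)
  ultimately have "card {y \<in> set xs. R (last xs) y} \<le> card P"
    by (meson surj_card_le)
  moreover have "{y \<in> set xs. R (hd xs) y} \<subseteq> (\<lambda>j. xs ! Suc j) ` Q"
  proof
    fix y assume y: "y \<in> {y \<in> set xs. R (hd xs) y}"
    then obtain j where j: "j < l" "y = xs ! j"
      by (auto simp: in_set_conv_nth l_def)
    have "j \<noteq> 0" using y j irr l by (metis (no_types, lifting) mem_Collect_eq)
    with j y show "y \<in> (\<lambda>j. xs ! Suc j) ` Q"
      by (intro image_eqI[of _ _ "j - 1"]) (auto simp: Q_def)
  qed
  then have "card {y \<in> set xs. R (hd xs) y} \<le> card Q"
    using \<open>finite Q\<close> by (meson surj_card_le)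
  ultimately have "card P + card Q \<ge> l"
    using deg[of "last xs"] deg[of "hd xs"] assms(3) by (simp add: l_def)
  \<comment> \<open>Pigeonhole: both index sets lie below \<open>l - 1\<close>, but their sizes add
    up to at least \<open>l\<close>.\<close>
  moreover have "card (P \<union> Q) \<le> card {..<l - 1}"
    by (intro card_mono) (auto simp: P_def Q_def)
  ultimately have "P \<inter> Q \<noteq> {}"
    using card_Un_Int[OF \<open>finite P\<close> \<open>finite Q\<close>] l by auto
  then obtain j where j: "j < l - 1" "R (last xs) (xs ! j)" "R (hd xs) (xs ! Suc j)"
    by (auto simp: P_def Q_def)
  define us vs where "us = take (Suc j) xs" and "vs = drop (Suc j) xs"
  have xs: "xs = us @ vs" by (simp add: us_def vs_def)
  have ne: "us \<noteq> []" "vs \<noteq> []"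
    using j l by (auto simp: us_def vs_def l_def)
  have "last us = xs ! j"
    using j by (simp add: us_def l_def take_Suc_conv_app_nth)
  moreover have "hd vs = xs ! Suc j"
    using j by (simp add: vs_def l_def hd_drop_conv_nth)
  moreover have "hd us = hd xs" "last vs = last xs"
    using ne by (simp_all add: xs)
  ultimately have "cyclic_gaps R (rev us @ vs) = gaps R us + gaps R vs"
    using j ne assms(1) by (simp add: cyclic_gaps_append gaps_rev last_rev hd_rev)
  moreover have "cyclic_gaps R xs > gaps R us + gaps R vs"
    using ne assms(4) by (simp add: xs cyclic_gaps_append)
  moreover have "set (rev us @ vs) = set xs" "distinct (rev us @ vs)"
    using assms(2) by (auto simp: xs)
  ultimately show thesis using that by metis
qed

text \<open>An ordering with the fewest cyclic gaps has none: \<open>two_opt\<close> would remove a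
  gap at the closing pair, and any other gap can be rotated there. For two elements the resulting
  cycle is degenerate, running along one pair in both directions, which is harmless for a cycle of
  cells.\<close>

theorem dirac:
  assumes "finite V" "V \<noteq> {}" "symp R" and irr: "\<And>x. \<not> R x x"
    and deg: "\<And>x. x \<in> V \<Longrightarrow> card V \<le> 2 * card {y \<in> V. R x y}"
  obtains xs where "distinct xs" "set xs = V" "successively R xs" "R (last xs) (hd xs)"
proof -
  define good where "good = (\<lambda>xs. distinct xs \<and> set xs = V)"
  obtain xs0 where "good xs0"
    using finite_distinct_list[OF assms(1)] by (auto simp: good_def)
  then obtain xs where xs: "good xs" "\<And>ys. good ys \<Longrightarrow> cyclic_gaps R xs \<le> cyclic_gaps R ys"
    using ex_has_least_nat[of good xs0 "cyclic_gaps R"] by blast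
  \<comment> \<open>Stated for every minimiser, so that it also applies to rotations of
    \<open>xs\<close>.\<close>
  have closed: "R (last ys) (hd ys)" if "good ys" "cyclic_gaps R ys = cyclic_gaps R xs" for ys
  proof (rule ccontr)
    assume "\<not> R (last ys) (hd ys)"
    moreover have "distinct ys" "set ys = V" "ys \<noteq> []" "length ys = card V"
      using that(1) assms(2) by (auto simp: good_def distinct_card)
    ultimately obtain zs where "set zs = set ys" "distinct zs" "cyclic_gaps R zs < cyclic_gaps R ys"
      using two_opt[of R ys] assms(3) irr deg by metis
    with xs(2)[of zs] that show False by (auto simp: good_def)
  qed
  have "gaps R xs = 0"
  proof (rule ccontr)
    assume "gaps R xs \<noteq> 0"
    then obtain ys zs where s: "xs = ys @ zs" "ys \<noteq> []" "zs \<noteq> []" "\<not> R (last ys) (hd zs)"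
      using gaps_pos_split by (metis neq0_conv)
    have "good (zs @ ys)" using xs(1) s by (auto simp: good_def)
    moreover have "cyclic_gaps R (zs @ ys) = cyclic_gaps R xs"
      using s by (simp add: cyclic_gaps_append)
    ultimately show False using closed[of "zs @ ys"] s by auto
  qed
  then show thesis
    using that[of xs] closed[of xs] xs(1) by (auto simp: good_def gaps_eq_0_iff)
qed

section \<open>Threading a path through a chain of cliques\<close>

text \<open>Every ordering of a clique is a path, so it is enough to put \<open>x\<close> first and
  \<open>y\<close> last.\<close>

lemma clique_path:
  assumes "finite Q" "x \<in> Q" "y \<in> Q" "x \<noteq> y \<or> Q = {x}"
    and clique: "\<And>u v. u \<in> Q \<Longrightarrow> v \<in> Q \<Longrightarrow> u \<noteq> v \<Longrightarrow> {u, v} \<in> E"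
  obtains vs where "vs \<noteq> []" "distinct vs" "set vs = Q" "hd vs = x" "last vs = y"
    "successively (\<lambda>u v. {u, v} \<in> E) vs"
proof -
  have succ: "successively (\<lambda>u v. {u, v} \<in> E) vs" if "distinct vs" "set vs \<subseteq> Q" for vs
    using that clique
    by (auto simp: successively_conv_nth nth_eq_iff_index_eq intro!: clique)
  show thesis
  proof (cases "x = y")
    case True
    with assms that[of "[x]"] show thesis by auto
  next
    case False
    obtain ws where "distinct ws" "set ws = Q - {x, y}"
      using finite_distinct_list[of "Q - {x, y}"] assms(1) by auto
    with False assms(2,3) that[of "x # ws @ [y]"] succ[of "x # ws @ [y]"] show thesis
      by (auto simp: insert_absorb)
  qed
qed

text \<open>\<open>x\<close> and \<open>y\<close> are the vertices where a Hamilton cycle enters \<open>P\<close> and leaves \<open>Q\<close>: it can pass from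
  \<open>P\<close> to \<open>Q\<close> at other vertices, except in singletons, where it enters and leaves at the same vertex.\<close>

definition linked :: "'a set set \<Rightarrow> 'a set \<Rightarrow> 'a set \<Rightarrow> bool" where
  "linked E P Q \<longleftrightarrow> (\<forall>x y. \<exists>u\<in>P. \<exists>v\<in>Q. {u, v} \<in> E \<and> (u \<noteq> x \<or> P = {u}) \<and> (v \<noteq> y \<or> Q = {v}))"

lemma linked_sym: "linked E P Q \<Longrightarrow> linked E Q P"
  unfolding linked_def by (metis insert_commute)

text \<open>Induction along the chain: walk through the first clique from \<open>x\<close> to the
  end of an edge into the next clique, and continue from the other end of that edge. The entry
  vertex varies in the induction, while the final vertex \<open>y\<close> stays fixed.\<close>

lemma thread_cliques:
  assumes "qs \<noteq> []" "distinct qs" "successively (\<lambda>p q. linked E (B p) (B q)) qs"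
    and "\<And>q. q \<in> set qs \<Longrightarrow> finite (B q)"
    and disj: "\<And>p q. p \<in> set qs \<Longrightarrow> q \<in> set qs \<Longrightarrow> p \<noteq> q \<Longrightarrow> B p \<inter> B q = {}"
    and clique: "\<And>q u v. q \<in> set qs \<Longrightarrow> u \<in> B q \<Longrightarrow> v \<in> B q \<Longrightarrow> u \<noteq> v \<Longrightarrow> {u, v} \<in> E"
    and "x \<in> B (hd qs)" "y \<in> B (last qs)" "x \<noteq> y \<or> (\<forall>q. qs = [q] \<longrightarrow> B q = {x})"
  shows "\<exists>vs. vs \<noteq> [] \<and> distinct vs \<and> set vs = (\<Union>q\<in>set qs. B q) \<and> hd vs = x \<and> last vs = y \<and>
    successively (\<lambda>u v. {u, v} \<in> E) vs"
  using assms
proof (induction qs arbitrary: x)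
  case (Cons q qs)
  show ?case
  proof (cases qs)
    case Nil
    with Cons.prems have "finite (B q)" "x \<in> B q" "y \<in> B q" "x \<noteq> y \<or> B q = {x}" by auto
    from clique_path[OF this, of E] Cons.prems(6) obtain vs where "vs \<noteq> []" "distinct vs" "set vs = B q"
      "hd vs = x" "last vs = y" "successively (\<lambda>u v. {u, v} \<in> E) vs"
      by (metis list.set_intros(1))
    with Nil show ?thesis by auto
  next
    case (Cons q' qs')
    have "linked E (B q) (B q')" using Cons Cons.prems(3) by simp
    \<comment> \<open>Linkedness is applied with \<open>x\<close> and \<open>y\<close> as forbidden
      vertices. Avoiding \<open>y\<close> matters only if \<open>q'\<close> is the last clique,
      where the remaining path must run from \<open>v\<close> to \<open>y\<close>.\<close>
    then obtain u v where uv: "u \<in> B q" "v \<in> B q'" "{u, v} \<in> E" "u \<noteq> x \<or> B q = {u}"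
      "v \<noteq> y \<or> B q' = {v}"
      unfolding linked_def by metis
    have "\<exists>ws. ws \<noteq> [] \<and> distinct ws \<and> set ws = (\<Union>q\<in>set qs. B q) \<and> hd ws = v \<and> last ws = y \<and>
      successively (\<lambda>u v. {u, v} \<in> E) ws"
    proof (rule Cons.IH)
      show "successively (\<lambda>p q. linked E (B p) (B q)) qs"
        using Cons Cons.prems(3) by simp
      show "{a, b} \<in> E" if "p \<in> set qs" "a \<in> B p" "b \<in> B p" "a \<noteq> b" for p a b
        using that Cons.prems(6)[of p a b] by simp
    qed (use Cons Cons.prems uv in \<open>auto simp del: successively.simps\<close>)
    then obtain ws where ws: "ws \<noteq> []" "distinct ws" "set ws = (\<Union>q\<in>set qs. B q)" "hd ws = v"
      "last ws = y" "successively (\<lambda>u v. {u, v} \<in> E) ws"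
      by blast
    have q: "finite (B q)" "x \<in> B q" "x \<noteq> u \<or> B q = {x}"
      using Cons.prems(4,7) uv by auto
    have clique: "{a, b} \<in> E" if "a \<in> B q" "b \<in> B q" "a \<noteq> b" for a b
      using that Cons.prems(6)[of q a b] by simp
    obtain vs where vs: "vs \<noteq> []" "distinct vs" "set vs = B q"
      "hd vs = x" "last vs = u" "successively (\<lambda>u v. {u, v} \<in> E) vs"
      by (rule clique_path[OF q(1,2) uv(1) q(3) clique])
    have "B q \<inter> (\<Union>q\<in>set qs. B q) = {}"
      using Cons.prems(2,5) by fastforce
    then show ?thesis
      using vs ws uv(3) by (intro exI[of _ "vs @ ws"]) (auto simp: successively_append_iff)
  qed
qed simp

section \<open>Hamilton cycles from a partition into cliques\<close>

lemma hamilton_cycle_cyclic_listI: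
  assumes "distinct vs" "set vs = V" "3 \<le> length vs" "successively (\<lambda>u v. {u, v} \<in> E) vs"
    "{last vs, hd vs} \<in> E"
  shows "hamilton_cycle V E vs"
proof -
  have "{vs ! i, vs ! (Suc i mod length vs)} \<in> E" if "i < length vs" for i
  proof (cases "Suc i = length vs")
    case True
    moreover from True have "i = length vs - 1" by simp
    moreover have "vs \<noteq> []" using assms(3) by auto
    ultimately show ?thesis
      using assms(5) by (simp add: last_conv_nth hd_conv_nth)
  next
    case False
    with that assms(4) show ?thesis by (auto simp: successively_conv_nth)
  qed
  with assms show ?thesis by (auto simp: hamilton_cycle_def)
qed

text \<open>The deterministic half of the proof. Dirac's theorem, applied to the nonempty cells with
  linkedness as adjacency, gives a cycle of cells, and \<open>thread_cliques\<close> turns it into a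
  cycle of vertices.\<close>

lemma has_hamilton_cycle_clique_partition:
  assumes fin: "finite V" "finite I" and ne: "V \<noteq> {}" and I: "f ` V \<subseteq> I" "8 \<le> card I"
    and clique: "\<And>u v. u \<in> V \<Longrightarrow> v \<in> V \<Longrightarrow> u \<noteq> v \<Longrightarrow> f u = f v \<Longrightarrow> {u, v} \<in> E"
    and few: "\<And>u. u \<in> V \<Longrightarrow> 8 * card {q \<in> I. card {v \<in> V. {u, v} \<in> E \<and> f v = q} \<le> 1} \<le> card I"
  shows "has_hamilton_cycle V E"
proof -
  define B where "B = (\<lambda>q. {v \<in> V. f v = q})"
  define poor where "poor = (\<lambda>u. {q \<in> I. card {v \<in> V. {u, v} \<in> E \<and> f v = q} \<le> 1})"
  define R where "R = (\<lambda>p q. p \<noteq> q \<and> linked E (B p) (B q))"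
  have finp: "finite (poor u)" for u using fin by (simp add: poor_def)
  have poor: "8 * card (poor u) \<le> card I" if "u \<in> V" for u
    using few[OF that] by (simp add: poor_def)
  \<comment> \<open>Two neighbours in \<open>q\<close> leave at least one that differs from the
    forbidden \<open>y\<close>.\<close>
  have nbr: "\<exists>v\<in>B q. {u, v} \<in> E \<and> v \<noteq> y" if "q \<in> I" "q \<notin> poor u" for q u y
  proof -
    have "\<not> {v \<in> V. {u, v} \<in> E \<and> f v = q} \<subseteq> {y}"
      using that card_mono[of "{y}" "{v \<in> V. {u, v} \<in> E \<and> f v = q}"] by (auto simp: poor_def)
    then show ?thesis by (auto simp: B_def)
  qed
  \<comment> \<open>Empty cells are poor for every vertex, so a cell that is not poor for some
    \<open>u\<close> is nonempty.\<close>
  have sub: "I - poor u \<subseteq> f ` V" for u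
    using nbr by (fastforce simp: B_def)
  have cardJ: "card (f ` V) \<le> card I"
    using I fin by (simp add: card_mono)
  have deg: "card (f ` V) \<le> 2 * card {q \<in> f ` V. R p q}" if p: "p \<in> f ` V" for p
  proof -
    \<comment> \<open>Two distinct vertices of \<open>p\<close>, or its only vertex twice: whichever
      \<open>x\<close> is forbidden, one of them can serve as the end of an edge.\<close>
    have "\<exists>a b. a \<in> B p \<and> b \<in> B p \<and> (a \<noteq> b \<or> B p = {a})"
      using p by (auto simp: B_def)
    then obtain a b where ab: "a \<in> B p" "b \<in> B p" "a \<noteq> b \<or> B p = {a}" by blast
    have R: "R p q" if q: "q \<in> I" "q \<noteq> p" "q \<notin> poor a" "q \<notin> poor b" for q
      unfolding R_def linked_def
    proof (intro conjI allI)
      fix x y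
      obtain u where u: "u \<in> {a, b}" "u \<noteq> x \<or> B p = {u}" using ab by blast
      with q nbr[of q u y] obtain v where "v \<in> B q" "{u, v} \<in> E" "v \<noteq> y" by auto
      with u ab show "\<exists>u\<in>B p. \<exists>v\<in>B q. {u, v} \<in> E \<and> (u \<noteq> x \<or> B p = {u}) \<and> (v \<noteq> y \<or> B q = {v})"
        by blast
    qed (use q in auto)
    \<comment> \<open>The cell \<open>p\<close> is linked to all cells but itself and those poor for
      \<open>a\<close> or \<open>b\<close>. At most 1 + |I| / 4 cells are lost, so at least |I| / 2
      remain because |I| is at least 8.\<close>
    have "card I - card (insert p (poor a \<union> poor b)) \<le> card (I - insert p (poor a \<union> poor b))"
      using finp by (intro diff_card_le_card_Diff) auto
    also have "\<dots> \<le> card {q \<in> f ` V. R p q}"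
      using R sub fin by (intro card_mono) auto
    finally have "card I \<le> card {q \<in> f ` V. R p q} + card (insert p (poor a \<union> poor b))" by simp
    moreover have "card (insert p (poor a \<union> poor b)) \<le> Suc (card (poor a) + card (poor b))"
      using finp card_Un_le[of "poor a" "poor b"] by (simp add: card_insert_if)
    moreover have "8 * card (poor a) \<le> card I" "8 * card (poor b) \<le> card I"
      using poor ab by (auto simp: B_def)
    ultimately show ?thesis using cardJ I(2) by linarith
  qed
  have "symp R"
    by (auto simp: R_def intro!: sympI linked_sym)
  moreover have "\<not> R p p" for p by (simp add: R_def)
  ultimately obtain qs where qs: "distinct qs" "set qs = f ` V" "successively R qs" "R (last qs) (hd qs)"
    by (rule dirac[of "f ` V" R, rotated 2]) (use fin ne deg in auto)
  have "qs \<noteq> []" using qs(2) ne by auto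
  \<comment> \<open>The closing edge is fixed first; its ends prescribe where the path through the
    cells has to start and stop.\<close>
  obtain y x where yx: "y \<in> B (last qs)" "x \<in> B (hd qs)" "{y, x} \<in> E"
    using qs(4) unfolding R_def linked_def by blast
  have "last qs \<noteq> hd qs" using qs(4) by (simp add: R_def)
  have "\<exists>vs. vs \<noteq> [] \<and> distinct vs \<and> set vs = (\<Union>q\<in>set qs. B q) \<and> hd vs = x \<and>
    last vs = y \<and> successively (\<lambda>u v. {u, v} \<in> E) vs"
  proof (rule thread_cliques)
    show "successively (\<lambda>p q. linked E (B p) (B q)) qs"
      using qs(3) by (rule successively_mono) (auto simp: R_def)
    show "{u, v} \<in> E" if "u \<in> B q" "v \<in> B q" "u \<noteq> v" for q u v
      using that clique by (simp add: B_def)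
    show "x \<noteq> y \<or> (\<forall>q. qs = [q] \<longrightarrow> B q = {x})"
      using yx \<open>last qs \<noteq> hd qs\<close> by (auto simp: B_def)
  qed (use qs(1) \<open>qs \<noteq> []\<close> fin yx in \<open>auto simp: B_def\<close>)
  then obtain vs where vs: "distinct vs" "set vs = (\<Union>q\<in>set qs. B q)" "hd vs = x" "last vs = y"
    "successively (\<lambda>u v. {u, v} \<in> E) vs"
    by blast
  have V: "set vs = V" using vs(2) qs(2) by (auto simp: B_def)
  obtain u where "u \<in> V" using ne by auto
  \<comment> \<open>At least 7/8 of the 8 or more cells are nonempty, so there are at least three
    vertices.\<close>
  have "card I - card (poor u) \<le> card (f ` V)"
    using diff_card_le_card_Diff[OF finp] card_mono[OF _ sub] fin by (meson finite_imageI le_trans)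
  also have "\<dots> \<le> length vs"
    using card_image_le[OF fin(1)] vs(1) V by (metis distinct_card)
  finally have "3 \<le> length vs"
    using poor[OF \<open>u \<in> V\<close>] I(2) by linarith
  then have "hamilton_cycle V E vs"
    using vs V yx(3) by (intro hamilton_cycle_cyclic_listI) simp_all
  then show ?thesis by (auto simp: has_hamilton_cycle_def)
qed

section \<open>A lower-tail Chernoff bound for independent points\<close>

text \<open>If Z counts the hits, independence makes the expectation of 2^(-Z) the product over
  \<open>S\<close> of 1 - \<open>measure M A\<close> / 2, while Z \<le> k means 2^(-Z) \<ge>
  2^(-k).\<close>

lemma measure_PiM_few_hits_le:
  fixes M :: "'a measure" and I :: "'i set"
  defines "P \<equiv> \<Pi>\<^sub>M i\<in>I. M"
  assumes "prob_space M" and A: "A \<in> sets M" and "finite I" "S \<subseteq> I" and p: "p \<le> measure M A"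
  shows "{X \<in> space P. card {i \<in> S. X i \<in> A} \<le> k} \<in> sets P"
    and "measure P {X \<in> space P. card {i \<in> S. X i \<in> A} \<le> k} \<le> 2 ^ k * (1 - p / 2) ^ card S"
proof -
  interpret M: prob_space M by fact
  interpret product_sigma_finite "\<lambda>_::'i. M" by unfold_locales
  interpret P: prob_space P
    unfolding P_def by (intro prob_space_PiM assms)
  have "finite S" using assms(4,5) by (rule rev_finite_subset)
  \<comment> \<open>\<open>h x\<close> is 2 to the minus indicator of \<open>A\<close>. Padding with
    the factor 1 outside \<open>S\<close> gives a product over all of \<open>I\<close>, the shape
    that \<open>product_nn_integral_prod\<close> integrates.\<close>
  define h where "h = (\<lambda>x. 1 - indicator A x / 2 :: real)"
  define g where "g = (\<lambda>i x. if i \<in> S then h x else 1)"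
  have h: "h x \<ge> 0" for x by (auto simp: h_def indicator_def)
  have g: "g i x \<ge> 0" for i x using h by (simp add: g_def)
  have hit: "(\<lambda>X. indicator A (X i) :: real) \<in> borel_measurable P" if "i \<in> S" for i
  proof -
    have [measurable]: "(\<lambda>X. X i) \<in> P \<rightarrow>\<^sub>M M"
      unfolding P_def using that assms(5) by (intro measurable_component_singleton) auto
    show ?thesis using A by measurable
  qed
  have count: "real (card {i \<in> S. X i \<in> A}) = (\<Sum>i\<in>S. indicator A (X i))" for X
    using \<open>finite S\<close> by (simp add: indicator_def sum.If_cases Int_def)
  have "{X \<in> space P. (\<Sum>i\<in>S. indicator A (X i)) \<le> real k} \<in> sets P"
    using hit by measurable
  then show meas: "{X \<in> space P. card {i \<in> S. X i \<in> A} \<le> k} \<in> sets P"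
    by (simp flip: count)
  let ?E = "{X \<in> space P. card {i \<in> S. X i \<in> A} \<le> k}"
  \<comment> \<open>Markov's inequality for \<open>2\<close> to the minus number of hits\<close>
  have markov: "indicator ?E X \<le> ennreal (2 ^ k) * (\<Prod>i\<in>I. ennreal (g i (X i)))" for X
  proof (cases "X \<in> ?E")
    case True
    have "(\<Prod>i\<in>I. g i (X i)) = (\<Prod>i\<in>S. h (X i))"
      using assms(4,5) by (simp add: g_def prod.If_cases Int_absorb1)
    also have "\<dots> = (\<Prod>i\<in>{i \<in> S. X i \<in> A}. 1 / 2)"
      using \<open>finite S\<close> by (intro prod.mono_neutral_cong_right) (auto simp: h_def)
    finally have "2 ^ k * (\<Prod>i\<in>I. g i (X i)) = 2 ^ k / 2 ^ card {i \<in> S. X i \<in> A}"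
      by (simp add: power_divide)
    also have "\<dots> \<ge> 1"
      using True by (simp add: field_simps power_increasing)
    finally show ?thesis
      using True g by (simp add: prod_ennreal prod_nonneg flip: ennreal_mult)
  qed auto
  have int_h: "(\<integral>\<^sup>+x. ennreal (h x) \<partial>M) = ennreal (1 - measure M A / 2)"
  proof (subst nn_integral_eq_integral)
    have int: "integrable M (\<lambda>x. indicator A x / 2 :: real)"
      using A by (intro integrable_divide integrable_real_indicator) (auto simp: M.emeasure_eq_measure)
    then show "integrable M h" by (auto simp: h_def)
    show "ennreal (integral\<^sup>L M h) = ennreal (1 - measure M A / 2)"
      using int A by (simp add: h_def M.prob_space)
  qed (use h in auto)
  have [measurable]: "h \<in> borel_measurable M"
    using A unfolding h_def by measurable
  have "(\<integral>\<^sup>+X. (\<Prod>i\<in>I. ennreal (g i (X i))) \<partial>P) = (\<Prod>i\<in>I. \<integral>\<^sup>+x. ennreal (g i x) \<partial>M)"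
    unfolding P_def by (rule product_nn_integral_prod) (use assms(4) in \<open>auto simp: g_def\<close>)
  also have "\<dots> = (\<Prod>i\<in>I. if i \<in> S then ennreal (1 - measure M A / 2) else 1)"
    by (intro prod.cong) (auto simp: g_def int_h M.emeasure_space_1)
  also have "\<dots> = ennreal (1 - measure M A / 2) ^ card S"
    using assms(4,5) by (simp add: prod.If_cases Int_absorb1)
  also have "\<dots> \<le> ennreal (1 - p / 2) ^ card S"
    using p by (intro power_mono ennreal_leI) auto
  finally have prod: "(\<integral>\<^sup>+X. (\<Prod>i\<in>I. ennreal (g i (X i))) \<partial>P) \<le> ennreal (1 - p / 2) ^ card S" .
  \<comment> \<open>Ensures that 1 - p / 2 is nonnegative, so that \<open>ennreal\<close> does not
    truncate it.\<close>
  have "p \<le> 1" using p M.prob_le_1[of A] by linarith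
  have "emeasure P ?E = (\<integral>\<^sup>+X. indicator ?E X \<partial>P)"
    using meas by (rule nn_integral_indicator[symmetric])
  also have "\<dots> \<le> (\<integral>\<^sup>+X. ennreal (2 ^ k) * (\<Prod>i\<in>I. ennreal (g i (X i))) \<partial>P)"
    by (intro nn_integral_mono markov)
  also have "\<dots> = ennreal (2 ^ k) * (\<integral>\<^sup>+X. (\<Prod>i\<in>I. ennreal (g i (X i))) \<partial>P)"
    unfolding P_def g_def using A by (intro nn_integral_cmult) measurable
  also have "\<dots> \<le> ennreal (2 ^ k) * ennreal (1 - p / 2) ^ card S"
    using prod by (intro mult_left_mono) auto
  also have "\<dots> = ennreal (2 ^ k * (1 - p / 2) ^ card S)"
    using \<open>p \<le> 1\<close> by (simp add: ennreal_power ennreal_mult)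
  finally show "measure P ?E \<le> 2 ^ k * (1 - p / 2) ^ card S"
    using \<open>p \<le> 1\<close> by (simp add: P.emeasure_eq_measure)
qed

section \<open>Cells of the unit cube\<close>

definition cell :: "nat \<Rightarrow> real ^ 'd \<Rightarrow> 'd \<Rightarrow> int" where
  "cell m x = (\<lambda>k. \<lfloor>real m * x $ k\<rfloor>)"

text \<open>Extensionality over \<open>UNIV\<close> is no restriction; the form with
  \<open>PiE\<close> gives access to its finiteness and cardinality rules.\<close>

definition grid :: "nat \<Rightarrow> ('d :: finite \<Rightarrow> int) set" where
  "grid m = (UNIV \<rightarrow>\<^sub>E {0..<int m})"

lemma finite_grid: "finite (grid m)"
  unfolding grid_def by (intro finite_PiE) auto

lemma card_grid: "card (grid m :: ('d :: finite \<Rightarrow> int) set) = m ^ CARD('d)"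
  unfolding grid_def by (simp add: card_PiE)

text \<open>The Euclidean norm is bounded by the l1 norm. This gives d / m instead of sqrt d / m, a
  loss that the constant C absorbs.\<close>

lemma norm_diff_le_if_same_cell:
  fixes x y :: "real ^ 'd"
  assumes "cell m x = cell m y" "m > 0"
  shows "norm (x - y) \<le> real CARD('d) / real m"
proof -
  have "\<bar>x $ k - y $ k\<bar> \<le> 1 / real m" for k
  proof -
    have "\<lfloor>real m * x $ k\<rfloor> = \<lfloor>real m * y $ k\<rfloor>"
      using assms(1) by (simp add: cell_def fun_eq_iff)
    then have "\<bar>real m * x $ k - real m * y $ k\<bar> \<le> 1" by linarith
    then have "real m * \<bar>x $ k - y $ k\<bar> \<le> 1"
      using assms(2) by (simp flip: right_diff_distrib add: abs_mult)
    then show ?thesis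
      using assms(2) by (simp add: field_simps)
  qed
  then have "(\<Sum>k\<in>UNIV. \<bar>(x - y) $ k\<bar>) \<le> (\<Sum>k\<in>(UNIV :: 'd set). 1 / real m)"
    by (intro sum_mono) auto
  with norm_le_l1_cart[of "x - y"] show ?thesis by simp
qed

abbreviation uniform_cube :: "(real ^ 'd) measure" where
  "uniform_cube \<equiv> uniform_measure lborel (cbox 0 1)"

lemma emeasure_unit_cube: "emeasure lborel (cbox 0 1 :: (real ^ 'd) set) = 1"
  by (subst emeasure_lborel_cbox) (auto simp: Basis_vec_def inner_axis intro!: prod.neutral)

lemma prob_space_uniform_cube: "prob_space (uniform_cube :: (real ^ 'd) measure)"
  by (intro prob_space_uniform_measure) (auto simp: emeasure_unit_cube)

lemma cell_vimage_borel: "{x :: real ^ 'd. cell m x = c} \<in> sets borel"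
proof -
  have "{x :: real ^ 'd. cell m x = c} = {x \<in> space borel. \<forall>k. \<lfloor>real m * x $ k\<rfloor> = c k}"
    by (auto simp: cell_def fun_eq_iff)
  also have "\<dots> \<in> sets borel" by measurable
  finally show ?thesis .
qed

text \<open>The cell contains an open box of side 1 / m lying inside the cube. A lower bound is all
  that the tail estimate asks for, and the open box avoids any care about boundaries.\<close>

lemma measure_cell_ge:
  fixes c :: "'d :: finite \<Rightarrow> int"
  assumes "c \<in> grid m" "m > 0"
  shows "measure uniform_cube {x :: real ^ 'd. cell m x = c} \<ge> 1 / real m ^ CARD('d)"
proof -
  define a b :: "real ^ 'd" where "a = (\<chi> k. c k / m)" and "b = (\<chi> k. (c k + 1) / m)"
  have c: "0 \<le> c k" "c k + 1 \<le> int m" for k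
    using assms(1) by (auto simp: grid_def PiE_iff Suc_le_eq add1_zle_eq)
  have c': "0 \<le> real_of_int (c k)" "real_of_int (c k) + 1 \<le> real m" for k
    using c[of k] by linarith+
  have "measure lborel (cbox a b) = (\<Prod>k\<in>(UNIV :: 'd set). 1 / real m)"
    using assms(2) by (subst content_cbox_cart)
      (auto simp: a_def b_def interval_ne_empty_cart field_simps intro!: prod.cong)
  then have "1 / real m ^ CARD('d) = measure lborel (box a b)"
    by (simp add: power_divide measure_lborel_box_eq measure_lborel_cbox_eq)
  also have "box a b \<subseteq> cbox 0 1 \<inter> {x. cell m x = c}"
  proof
    fix x assume "x \<in> box a b"
    then have x: "c k < real m * x $ k" "real m * x $ k < c k + 1" for k
      using assms(2) by (auto simp: a_def b_def mem_box_cart field_simps)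
    have "0 < real m * x $ k" "real m * x $ k < real m * 1" for k
      using x[of k] c'[of k] by linarith+
    then have "0 \<le> x $ k \<and> x $ k \<le> 1" for k
      using assms(2) by (auto simp: zero_less_mult_iff intro: less_imp_le)
    moreover have "cell m x = c"
      using x by (auto simp: cell_def fun_eq_iff floor_eq_iff intro: less_imp_le)
    ultimately show "x \<in> cbox 0 1 \<inter> {x. cell m x = c}"
      by (auto simp: mem_box_cart)
  qed
  then have "measure lborel (box a b) \<le> measure lborel (cbox 0 1 \<inter> {x. cell m x = c})"
    using cell_vimage_borel[of m c] emeasure_unit_cube[where 'd = 'd]
    by (intro measure_mono_fmeasurable fmeasurable_Int_fmeasurable) (auto simp: fmeasurable_def)
  also have "\<dots> = measure uniform_cube {x. cell m x = c}"
    using cell_vimage_borel[of m c]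
    by (subst measure_uniform_measure) (auto simp: emeasure_unit_cube measure_def)
  finally show ?thesis .
qed

lemma measure_cells_ge:
  fixes T :: "('d :: finite \<Rightarrow> int) set"
  assumes "T \<subseteq> grid m" "m > 0"
  shows "measure uniform_cube {x :: real ^ 'd. cell m x \<in> T} \<ge> card T / real m ^ CARD('d)"
    and "{x :: real ^ 'd. cell m x \<in> T} \<in> sets uniform_cube"
proof -
  interpret prob_space "uniform_cube :: (real ^ 'd) measure" by (rule prob_space_uniform_cube)
  have T: "finite T" using assms(1) finite_grid by (rule finite_subset)
  have eq: "{x :: real ^ 'd. cell m x \<in> T} = (\<Union>c\<in>T. {x. cell m x = c})" by auto
  show "{x :: real ^ 'd. cell m x \<in> T} \<in> sets uniform_cube"
    unfolding eq using T cell_vimage_borel by auto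
  have "card T / real m ^ CARD('d) = (\<Sum>c\<in>T. 1 / real m ^ CARD('d))" by simp
  also have "\<dots> \<le> (\<Sum>c\<in>T. measure uniform_cube {x :: real ^ 'd. cell m x = c})"
    using assms by (intro sum_mono measure_cell_ge) auto
  also have "\<dots> = measure uniform_cube {x :: real ^ 'd. cell m x \<in> T}"
    unfolding eq using T cell_vimage_borel
    by (intro finite_measure_finite_Union[symmetric]) (auto simp: disjoint_family_on_def)
  finally show "measure uniform_cube {x :: real ^ 'd. cell m x \<in> T} \<ge> card T / real m ^ CARD('d)" .
qed

text \<open>A point with a coordinate equal to 1 has cell index m there and falls outside the grid,
  but the boundary of the cube is a null set.\<close>

lemma AE_cell_in_grid:
  assumes "m > 0"
  shows "AE x in (uniform_cube :: (real ^ 'd) measure). cell m x \<in> grid m"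
proof -
  interpret prob_space "uniform_cube :: (real ^ 'd) measure" by (rule prob_space_uniform_cube)
  have "box 0 1 \<subseteq> (cbox 0 1 :: (real ^ 'd) set)" by (rule box_subset_cbox)
  then have "measure uniform_cube (box 0 1 :: (real ^ 'd) set) = measure lborel (box 0 1 :: (real ^ 'd) set)"
    by (subst measure_uniform_measure) (auto simp: emeasure_unit_cube measure_def Int_absorb1)
  also have "\<dots> = 1"
    using emeasure_unit_cube[where 'd = 'd]
    by (simp add: measure_def emeasure_lborel_cbox_eq emeasure_lborel_box_eq)
  finally have "AE x :: real ^ 'd in uniform_cube. x \<in> box 0 1"
    by (rule AE_prob_1)
  then show ?thesis
  proof eventually_elim
    case (elim x)
    then have "0 \<le> x $ k \<and> x $ k < 1" for k
      by (auto simp: mem_box_cart intro: less_imp_le)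
    then have "0 \<le> real m * x $ k \<and> real m * x $ k < real m" for k
      using assms by simp
    then show ?case
      by (auto simp: cell_def grid_def PiE_iff floor_less_iff)
  qed
qed

section \<open>The failure probability for fixed n and m\<close>

lemma uniform_points_eq: "uniform_points n = (\<Pi>\<^sub>M i\<in>{1..n}. uniform_cube)"
  by (simp add: uniform_points_def unit_cube_eq_cbox)

lemma card_nbrs_eq_vertex_degree:
  assumes "simple_graph V E"
  shows "card {v \<in> V. {u, v} \<in> E} = vertex_degree E u"
proof -
  have inj: "inj_on (\<lambda>v. {u, v}) {v \<in> V. {u, v} \<in> E}"
    by (rule inj_onI) (metis doubleton_eq_iff)
  have "e \<in> (\<lambda>v. {u, v}) ` {v \<in> V. {u, v} \<in> E}" if e: "e \<in> E" "u \<in> e" for e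
  proof -
    from assms e(1) have "card e = 2" "e \<subseteq> V" unfolding simple_graph_def by blast+
    then obtain a b where "e = {a, b}" unfolding card_2_iff by blast
    then obtain v where "e = {u, v}" using e(2) by (cases "u = a") blast+
    then show ?thesis using e \<open>e \<subseteq> V\<close> by blast
  qed
  then have image: "(\<lambda>v. {u, v}) ` {v \<in> V. {u, v} \<in> E} = {e \<in> E. u \<in> e}" by blast
  show ?thesis
    using card_image[OF inj] unfolding image vertex_degree_def by (rule sym)
qed

text \<open>Union bound over the n vertices and the at most 2^N sets \<open>T\<close> of at least N
  / 8 cells. Each pair contributes at most 2^N (15/16)^(\<alpha>n), which explains the factor
  4^N.\<close>

lemma measure_not_hamilton_le:
  fixes H :: "nat set set" and r \<alpha> :: real and m n :: nat
  defines "U \<equiv> uniform_points n :: (nat \<Rightarrow> real ^ 'd) measure"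
    and "N \<equiv> m ^ CARD('d)"
  assumes H: "simple_graph {1..n} H" "\<alpha> * n \<le> min_degree {1..n} H" and "n > 0" "m > 0"
    and r: "CARD('d) / m \<le> r" and N: "8 \<le> N"
  shows "measure U {X \<in> space U. \<not> has_hamilton_cycle {1..n} (H \<union> geometric_graph n r X)}
    \<le> n * 4 ^ N * (15 / 16) powr (\<alpha> * n)"
proof -
  interpret prob_space U unfolding U_def by (rule prob_space_uniform_points)
  define S where "S = (\<lambda>u. {v \<in> {1..n}. {u, v} \<in> H})"
  define \<T> where "\<T> = {T :: ('d \<Rightarrow> int) set. T \<subseteq> grid m \<and> N \<le> 8 * card T}"
  define few where "few = (\<lambda>u T. {X \<in> space U. card {v \<in> S u. X v \<in> {x. cell m x \<in> T}} \<le> card T})"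
  let ?bad = "{X \<in> space U. \<not> has_hamilton_cycle {1..n} (H \<union> geometric_graph n r X)}"
  have fin: "finite (grid m :: ('d \<Rightarrow> int) set)" by (rule finite_grid)
  have few: "few u T \<in> sets U \<and> measure U (few u T) \<le> 2 ^ N * (15 / 16) powr (\<alpha> * n)"
    if u: "u \<in> {1..n}" and T: "T \<in> \<T>" for u T
  proof -
    have sub: "T \<subseteq> grid m" and card: "N \<le> 8 * card T" using T by (auto simp: \<T>_def)
    \<comment> \<open>A point hits \<open>T\<close> with probability at least 1/8; halving this in
      the Chernoff bound leaves the base 15/16 = 1 - 1/16.\<close>
    have "1 / 8 \<le> card T / real m ^ CARD('d)"
      using card \<open>m > 0\<close> by (simp add: N_def field_simps flip: of_nat_power of_nat_mult)
    also have "\<dots> \<le> measure uniform_cube {x :: real ^ 'd. cell m x \<in> T}"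
      by (rule measure_cells_ge(1)[OF sub \<open>m > 0\<close>])
    finally have p: "1 / 8 \<le> measure uniform_cube {x :: real ^ 'd. cell m x \<in> T}" .
    have S: "S u \<subseteq> {1..n}" by (auto simp: S_def)
    note * = measure_PiM_few_hits_le[OF prob_space_uniform_cube measure_cells_ge(2)[OF sub \<open>m > 0\<close>]
        finite_atLeastAtMost S p, of "card T", folded uniform_points_eq U_def]
    have "measure U (few u T) \<le> 2 ^ card T * (15 / 16) ^ card (S u)"
      using *(2) by (simp add: few_def)
    also have "\<dots> \<le> 2 ^ N * (15 / 16) powr (\<alpha> * n)"
    proof (intro mult_mono)
      show "(2 :: real) ^ card T \<le> 2 ^ N"
        using card_mono[OF fin sub] by (intro power_increasing) (simp_all add: card_grid N_def)
      have "min_degree {1..n} H \<le> card (S u)"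
        using u unfolding min_degree_def S_def card_nbrs_eq_vertex_degree[OF H(1)]
        by (intro Min_le) auto
      with H(2) have "\<alpha> * n \<le> card (S u)" by linarith
      then have "(15 / 16 :: real) powr card (S u) \<le> (15 / 16) powr (\<alpha> * n)"
        by (intro powr_mono') auto
      then show "(15 / 16 :: real) ^ card (S u) \<le> (15 / 16) powr (\<alpha> * n)"
        by (simp add: powr_realpow)
    qed auto
    finally show ?thesis using *(1) by (simp add: few_def)
  qed
  have fin\<T>: "finite \<T>"
    by (rule finite_subset[of _ "Pow (grid m)"]) (use fin in \<open>auto simp: \<T>_def\<close>)
  have card\<T>: "card \<T> \<le> 2 ^ N"
    using card_mono[of "Pow (grid m)" \<T>] fin by (auto simp: \<T>_def card_Pow card_grid N_def)
  have ham: "has_hamilton_cycle {1..n} (H \<union> geometric_graph n r X)"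
    if X: "X \<in> space U" "\<And>i. i \<in> {1..n} \<Longrightarrow> cell m (X i) \<in> grid m"
      and nofew: "X \<notin> (\<Union>(u, T)\<in>{1..n} \<times> \<T>. few u T)" for X
  proof (rule has_hamilton_cycle_clique_partition)
    show "finite {1..n}" "finite (grid m :: ('d \<Rightarrow> int) set)" "{1..n} \<noteq> {}"
      using fin \<open>n > 0\<close> by auto
    show "(\<lambda>i. cell m (X i)) ` {1..n} \<subseteq> grid m" using X by auto
    show "8 \<le> card (grid m :: ('d \<Rightarrow> int) set)" using N by (simp add: card_grid N_def)
    show "{u, v} \<in> H \<union> geometric_graph n r X"
      if "u \<in> {1..n}" "v \<in> {1..n}" "u \<noteq> v" "cell m (X u) = cell m (X v)" for u v
      using that norm_diff_le_if_same_cell[of m "X u" "X v"] \<open>m > 0\<close> r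
      by (simp add: doubleton_in_geometric_graph)
    fix u assume u: "u \<in> {1..n}"
    define T where "T = {q \<in> grid m. card {v \<in> {1..n}. {u, v} \<in> H \<union> geometric_graph n r X \<and> cell m (X v) = q} \<le> 1}"
    have finT: "finite T" using fin by (simp add: T_def)
    \<comment> \<open>\<open>T\<close> collects the cells that are poor for \<open>u\<close>. Each
      contains at most one \<open>H\<close>-neighbour of \<open>u\<close>, so \<open>T\<close> as a
      whole receives at most \<open>card T\<close> of them. If \<open>T\<close> had at least N / 8
      cells, \<open>X\<close> would lie in one of the excluded events.\<close>
    have "card {v \<in> S u. cell m (X v) \<in> T} = card (\<Union>q\<in>T. {v \<in> S u. cell m (X v) = q})"
      by (intro arg_cong[of _ _ card]) auto
    also have "\<dots> \<le> (\<Sum>q\<in>T. card {v \<in> S u. cell m (X v) = q})"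
      using finT by (rule card_UN_le)
    also have "\<dots> \<le> (\<Sum>q\<in>T. 1)"
    proof (intro sum_mono)
      fix q assume "q \<in> T"
      have "card {v \<in> S u. cell m (X v) = q} \<le>
          card {v \<in> {1..n}. {u, v} \<in> H \<union> geometric_graph n r X \<and> cell m (X v) = q}"
        by (intro card_mono) (auto simp: S_def)
      also have "\<dots> \<le> 1" using \<open>q \<in> T\<close> by (simp add: T_def)
      finally show "card {v \<in> S u. cell m (X v) = q} \<le> 1" .
    qed
    finally have "X \<in> few u T"
      using X by (simp add: few_def)
    with nofew u have "T \<notin> \<T>" by blast
    then show "8 * card {q \<in> grid m. card {v \<in> {1..n}. {u, v} \<in> H \<union> geometric_graph n r X \<and> cell m (X v) = q} \<le> 1}
        \<le> card (grid m :: ('d \<Rightarrow> int) set)"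
      by (auto simp: \<T>_def T_def card_grid N_def)
  qed
  have "AE X in U. \<forall>i\<in>{1..n}. cell m (X i) \<in> grid m"
    unfolding U_def uniform_points_eq using \<open>m > 0\<close>
    by (intro AE_finite_allI AE_PiM_component prob_space_uniform_cube AE_cell_in_grid) auto
  \<comment> \<open>The inclusion in the union holds only up to the null event that some point lies
    outside the grid.\<close>
  then have "AE X in U. X \<in> ?bad \<longrightarrow> X \<in> (\<Union>(u, T)\<in>{1..n} \<times> \<T>. few u T)"
  proof eventually_elim
    case (elim X)
    then show ?case using ham[of X] by blast
  qed
  then have "measure U ?bad \<le> measure U (\<Union>(u, T)\<in>{1..n} \<times> \<T>. few u T)"
    using few fin\<T> by (intro finite_measure_mono_AE) auto
  also have "\<dots> \<le> (\<Sum>(u, T)\<in>{1..n} \<times> \<T>. measure U (few u T))"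
    unfolding case_prod_unfold using few fin\<T>
    by (intro finite_measure_subadditive_finite) auto
  also have "\<dots> \<le> (\<Sum>(u, T)\<in>{1..n} \<times> \<T>. 2 ^ N * (15 / 16) powr (\<alpha> * n))"
    using few by (intro sum_mono) auto
  also have "\<dots> = n * card \<T> * (2 ^ N * (15 / 16) powr (\<alpha> * n))"
    by (simp add: case_prod_unfold card_cartesian_product)
  also have "\<dots> \<le> n * 2 ^ N * (2 ^ N * (15 / 16) powr (\<alpha> * n))"
  proof (intro mult_right_mono)
    have "real (card \<T>) \<le> real (2 ^ N)" using card\<T> by (rule of_nat_mono)
    then show "real (n * card \<T>) \<le> n * 2 ^ N" by (simp add: mult_left_mono)
  qed simp
  also have "\<dots> = n * 4 ^ N * (15 / 16) powr (\<alpha> * n)"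
    by (simp flip: power_mult_distrib)
  finally show ?thesis .
qed

section \<open>Choice of the grid and of the constants\<close>

text \<open>With C = K (2d)^d and t = (n / C)^(1/d), take m = d t rounded up. Then d / m \<le> 1 / t
  is the required diameter bound, and m \<le> 2 d t gives m^d \<le> n / K.\<close>

lemma grid_size_exists:
  fixes K :: real
  assumes K: "K > 0" and n: "n > 0"
    and large: "8 * (K * (2 * real CARD('d)) ^ CARD('d)) \<le> n"
  obtains m where "m > 0" "8 \<le> m ^ CARD('d::finite)" "real (m ^ CARD('d)) \<le> n / K"
    "CARD('d) / m \<le> (K * (2 * real CARD('d)) ^ CARD('d) / n) powr (1 / CARD('d))"
proof -
  define d where "d = CARD('d)"
  define C where "C = K * (2 * real d) ^ d"
  define t where "t = (n / C) powr (1 / d)"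
  define m where "m = nat \<lceil>d * t\<rceil>"
  have d: "d \<ge> 1" by (simp add: d_def Suc_le_eq)
  have C: "C > 0" using K d by (simp add: C_def)
  have t: "t > 0" "t ^ d = n / C"
    using C n d by (auto simp: t_def powr_powr simp flip: powr_realpow)
  have td: "t ^ d \<ge> 8"
  proof -
    have "8 * C \<le> n" using large by (simp only: C_def d_def)
    then show ?thesis using C by (simp add: t(2) field_simps)
  qed
  then have "t \<ge> 1"
    using power_le_one[of t d] t(1) by linarith
  \<comment> \<open>Because d t is at least 1, rounding it up at most doubles it.\<close>
  then have dt: "d * t \<ge> 1" using d mult_mono[of 1 "real d" 1 t] by simp
  have m: "d * t \<le> m" "m \<le> d * t + 1"
    using dt unfolding m_def by linarith+
  show thesis
  proof (rule that, fold d_def)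
    show "m > 0" using m dt by (auto intro: Nat.gr0I)
    have "8 \<le> t ^ d" by fact
    also have "\<dots> \<le> real m ^ d"
      using m t d by (intro power_mono) (auto intro: order_trans[OF _ m(1)] simp: mult_le_cancel_right1)
    finally show "8 \<le> m ^ d" by (simp flip: of_nat_power)
    have "real m ^ d \<le> (2 * d * t) ^ d"
      using m dt by (intro power_mono) auto
    also have "\<dots> = n / K"
      using d K by (simp add: power_mult_distrib t(2) C_def)
    finally show "real (m ^ d) \<le> n / K" by simp
    have "d / m \<le> 1 / t"
      using m t \<open>m > 0\<close> by (simp add: field_simps)
    also have "\<dots> = (C / n) powr (1 / d)"
      using C n by (simp add: t_def powr_divide)
    finally show "d / m \<le> (K * (2 * real d) ^ d / n) powr (1 / d)" by (simp add: C_def)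
  qed
qed

theorem theorem1p1:
  fixes \<alpha> :: real
  assumes "0 < \<alpha>" and "\<alpha> < 1 / 2"
  shows "\<exists>C>0. \<forall>(r :: nat \<Rightarrow> real) (H :: nat \<Rightarrow> nat set set).
    (\<forall>\<^sub>F n in sequentially. r n \<ge> (C / real n) powr (1 / real CARD('d))) \<longrightarrow>
    (\<forall>\<^sub>F n in sequentially. simple_graph {1..n} (H n) \<and>
       real (min_degree {1..n} (H n)) \<ge> \<alpha> * real n) \<longrightarrow>
    asymptotically_almost_surely (\<lambda>n. uniform_points n :: (nat \<Rightarrow> real ^ 'd) measure)
      (\<lambda>n X. has_hamilton_cycle {1..n} (H n \<union> geometric_graph n (r n) X))"
proof -
  \<comment> \<open>Chosen so that 4^(n/K) = (16/15)^(\<alpha>n/2). With N \<le> n / K the factor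
    4^N then cancels only half of the exponent in (15/16)^(\<alpha>n), which leaves
    \<open>\<beta>\<close> = (15/16)^(\<alpha>/2) < 1.\<close>
  define K :: real where "K = 2 * ln 4 / (\<alpha> * ln (16 / 15))"
  define C where "C = K * (2 * real CARD('d)) ^ CARD('d)"
  define \<beta> where "\<beta> = exp (- \<alpha> * ln (16 / 15) / 2 :: real)"
  have K: "K > 0" using assms by (simp add: K_def)
  have \<beta>: "0 < \<beta>" "\<beta> < 1" using assms by (simp_all add: \<beta>_def)
  show ?thesis
  proof (intro exI[of _ C] conjI allI impI)
    show "C > 0" using K by (simp add: C_def)
    fix r :: "nat \<Rightarrow> real" and H :: "nat \<Rightarrow> nat set set"
    assume ev: "\<forall>\<^sub>F n in sequentially. r n \<ge> (C / real n) powr (1 / real CARD('d))"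
      "\<forall>\<^sub>F n in sequentially. simple_graph {1..n} (H n) \<and> real (min_degree {1..n} (H n)) \<ge> \<alpha> * real n"
    let ?U = "\<lambda>n. uniform_points n :: (nat \<Rightarrow> real ^ 'd) measure"
    let ?ham = "\<lambda>n X. has_hamilton_cycle {1..n} (H n \<union> geometric_graph n (r n) X)"
    \<comment> \<open>The second bound makes the grid have at least 8 cells.\<close>
    have "\<forall>\<^sub>F n in sequentially. n > 0 \<and> 8 * C \<le> real n"
      by (intro eventually_conj eventually_gt_at_top
          filterlim_real_sequentially[unfolded filterlim_at_top, rule_format])
    with ev have "\<forall>\<^sub>F n in sequentially. 1 - n * \<beta> ^ n \<le> measure (?U n) {X \<in> space (?U n). ?ham n X}"
    proof eventually_elim
      case (elim n)
      interpret prob_space "?U n" by (rule prob_space_uniform_points)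
      obtain m where m: "m > 0" "8 \<le> m ^ CARD('d)" "real (m ^ CARD('d)) \<le> n / K"
        "CARD('d) / m \<le> (C / n) powr (1 / CARD('d))"
        using grid_size_exists[where 'd = 'd, OF K, of n] elim by (auto simp: C_def)
      have "measure (?U n) {X \<in> space (?U n). \<not> ?ham n X} \<le>
          n * 4 ^ (m ^ CARD('d)) * (15 / 16) powr (\<alpha> * n)"
        using m elim by (intro measure_not_hamilton_le) auto
      also have "\<dots> \<le> n * \<beta> ^ n"
      proof -
        have ln: "ln (15 / 16 :: real) = - ln (16 / 15)" by (simp add: ln_div)
        have "(4 :: real) ^ (m ^ CARD('d)) = 4 powr real (m ^ CARD('d))"
          by (rule powr_realpow[symmetric]) simp
        also have "\<dots> \<le> 4 powr (n / K)" using m by (intro powr_mono) auto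
        also have "\<dots> = exp (n * (\<alpha> * ln (16 / 15) / 2))"
          using assms by (simp add: powr_def K_def)
        finally have "4 ^ (m ^ CARD('d)) * (15 / 16) powr (\<alpha> * n) \<le>
            exp (n * (\<alpha> * ln (16 / 15) / 2)) * (15 / 16) powr (\<alpha> * n)"
          by (intro mult_right_mono) auto
        also have "\<dots> = \<beta> ^ n"
          by (simp add: powr_def ln \<beta>_def field_simps flip: exp_add exp_of_nat_mult)
        finally show ?thesis by (simp add: mult_left_mono mult.assoc)
      qed
      finally have "measure (?U n) {X \<in> space (?U n). \<not> ?ham n X} \<le> n * \<beta> ^ n" .
      moreover have "measure (?U n) {X \<in> space (?U n). \<not> ?ham n X} = 1 - measure (?U n) {X \<in> space (?U n). ?ham n X}"
        by (rule prob_neg[OF sets_has_hamilton_cycle])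
      ultimately show ?case by linarith
    qed
    moreover have "\<forall>\<^sub>F n in sequentially. measure (?U n) {X \<in> space (?U n). ?ham n X} \<le> 1"
      by (intro always_eventually allI prob_space.prob_le_1 prob_space_uniform_points)
    moreover have "(\<lambda>n. 1 - n * \<beta> ^ n) \<longlonglongrightarrow> 1 - 0"
      using \<beta> by (intro tendsto_diff tendsto_const powser_times_n_limit_0) auto
    then have "(\<lambda>n. 1 - n * \<beta> ^ n) \<longlonglongrightarrow> 1" by simp
    ultimately show "asymptotically_almost_surely ?U ?ham"
      unfolding asymptotically_almost_surely_def by (rule real_tendsto_sandwich) (rule tendsto_const)
  qed
qed

end
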